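(* Consider the non-linear first order PDE for a function $t=t(x^0,x^1,x^2,x^3,x^4)$: $$(x^1+3t x^2)\,t_{x^0}+t^3t_{x^1}-t^2t_{x^2}+t\,t_{x^3}-t_{x^4}=0.\qquad( * )$$ The general smooth solution to the equation $( * )$ is obtainable locally by choosing an arbitrary smooth function $F$ of five variables and solving the equation $$F\big(x^0+x^1x^4+3t x^2x^4-t^3(x^4)^2,\;x^1+t^3x^4,\;x^2-t^2x^4,\;x^3+t x^4,\;t\big)=0$$ for $t$ in terms of $x^0,x^1,x^2,x^3,x^4$.
   Context: $(x^0,x^1,x^2,x^3,x^4)$ are coordinates on an open subset of $\mathbb R^5$, and subscripts $x^i$ denote partial derivatives. All functions are smooth and all considerations are local. *)

theory Defs
  imports "HOL-Analysis.Analysis"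
begin

text \<open>\<open>C\<^sup>k\<close> regularity on a set, intended for open sets only: the derivative is the unrestricted one.\<close>

primrec Ck_on :: "nat \<Rightarrow> 'a::euclidean_space set \<Rightarrow> ('a \<Rightarrow> real) \<Rightarrow> bool" where
  "Ck_on 0 S f \<longleftrightarrow> continuous_on S f"
| "Ck_on (Suc k) S f \<longleftrightarrow>
     (\<forall>x\<in>S. f differentiable (at x)) \<and>
     (\<forall>v. Ck_on k S (\<lambda>x. frechet_derivative f (at x) v))"

definition smooth_on :: "'a::euclidean_space set \<Rightarrow> ('a \<Rightarrow> real) \<Rightarrow> bool" where
  "smooth_on S f \<longleftrightarrow> (\<forall>k. Ck_on k S f)"

text \<open>
  The index type \<open>5\<close> is the integers mod 5, with the five distinct elements 0, 1, 2, 3, 4;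
  so the coordinate \<open>x\<^sup>i\<close> is \<open>x $ i\<close>.
\<close>

definition partial :: "5 \<Rightarrow> (real ^ 5 \<Rightarrow> real) \<Rightarrow> real ^ 5 \<Rightarrow> real" where
  "partial i f x = frechet_derivative f (at x) (axis i 1)"

definition solves_pde_on :: "(real ^ 5) set \<Rightarrow> (real ^ 5 \<Rightarrow> real) \<Rightarrow> bool" where
  "solves_pde_on U t \<longleftrightarrow>
     (\<forall>x\<in>U. (x $ 1 + 3 * t x * x $ 2) * partial 0 t x + t x ^ 3 * partial 1 t x
             - t x ^ 2 * partial 2 t x + t x * partial 3 t x - partial 4 t x = 0)"

text \<open>The five arguments of \<open>F\<close>, for an unknown value \<open>s\<close> of \<open>t\<close>.\<close>

definition F_args :: "real ^ 5 \<Rightarrow> real \<Rightarrow> real ^ 5" where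
  "F_args x s = (\<chi> i.
     if i = 0 then x $ 0 + x $ 1 * x $ 4 + 3 * s * x $ 2 * x $ 4 - s ^ 3 * (x $ 4) ^ 2
     else if i = 1 then x $ 1 + s ^ 3 * x $ 4
     else if i = 2 then x $ 2 - s ^ 2 * x $ 4
     else if i = 3 then x $ 3 + s * x $ 4
     else s)"

text \<open>
  Near \<open>p\<close>, solving \<open>F (F_args x s) = 0\<close> for \<open>s\<close> in terms of \<open>x\<close> yields \<open>s = t x\<close>: in a
  neighbourhood of \<open>(p, t p)\<close> the zero set of the equation is exactly the graph of \<open>t\<close>.
  Here \<open>F\<close> has domain \<open>W\<close> and \<open>t\<close> has domain \<open>U\<close>.
\<close>

definition obtained_by_solving_near ::
  "(real ^ 5) set \<Rightarrow> (real ^ 5 \<Rightarrow> real) \<Rightarrow> (real ^ 5) set \<Rightarrow> (real ^ 5 \<Rightarrow> real) \<Rightarrow> real ^ 5 \<Rightarrow> bool" where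
  "obtained_by_solving_near W F U t p \<longleftrightarrow>
     (\<exists>N. open N \<and> (p, t p) \<in> N \<and>
        (\<forall>(x, s)\<in>N. x \<in> U \<and> F_args x s \<in> W \<and> (F (F_args x s) = 0 \<longleftrightarrow> s = t x)))"

text \<open>The hypothesis of the implicit function theorem for solving the equation for \<open>s\<close>.\<close>

definition solvable_at :: "(real ^ 5) set \<Rightarrow> (real ^ 5 \<Rightarrow> real) \<Rightarrow> real ^ 5 \<Rightarrow> real \<Rightarrow> bool" where
  "solvable_at W F p s \<longleftrightarrow>
     F_args p s \<in> W \<and> F (F_args p s) = 0 \<and> deriv (\<lambda>r. F (F_args p r)) s \<noteq> 0"

end

theory Submission
  imports Defs
begin

text \<open>
  With \<open>s\<close> fixed, the level sets of \<open>x \<mapsto> F_args x s\<close> are explicit polynomial curves, and their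
  direction is the characteristic direction of the PDE for the value \<open>s\<close> of \<open>t\<close>, reversed so that
  \<open>x\<^sup>4\<close> increases at unit speed. If the zero set of \<open>F (F_args x s)\<close> is locally the graph of \<open>t\<close>, then
  \<open>t\<close> is constant along these curves, which is the PDE.
  Conversely, a solution is constant along them, so transporting each point along its curve to the
  hyperplane \<open>x\<^sup>4 = p\<^sup>4\<close> and comparing the value of \<open>t\<close> there with \<open>s\<close> gives a suitable \<open>F\<close>.
  Solvability is the smooth implicit function theorem.
\<close>

subsection \<open>Calculus of smooth functions\<close>

text \<open>Openness turns agreement on \<open>S\<close> into agreement near each point of
  \<open>S\<close>, so the derivatives agree there too and the induction can descend to
  them.\<close>

lemma Ck_on_cong:
  assumes "open S" "\<And>x. x \<in> S \<Longrightarrow> f x = g x" "Ck_on k S f"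
  shows "Ck_on k S g"
  using assms(2,3)
proof (induction k arbitrary: f g)
  case 0
  then show ?case by (metis Ck_on.simps(1) continuous_on_cong)
next
  case (Suc k)
  have fd: "frechet_derivative f (at x) = frechet_derivative g (at x)" and "g differentiable (at x)" if "x \<in> S" for x
  proof -
    have "f differentiable (at x)" using Suc.prems that by simp
    then have "(f has_derivative frechet_derivative f (at x)) (at x)"
      by (simp add: frechet_derivative_works)
    then have g: "(g has_derivative frechet_derivative f (at x)) (at x)"
      using has_derivative_transform_within_open[OF _ assms(1) that] Suc.prems(1) by blast
    then show "frechet_derivative f (at x) = frechet_derivative g (at x)" "g differentiable (at x)"
      by (auto intro: frechet_derivative_at differentiableI)
  qed
  moreover have "Ck_on k S (\<lambda>x. frechet_derivative g (at x) v)" for v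
    by (rule Suc.IH[of "\<lambda>x. frechet_derivative f (at x) v"]) (use Suc.prems fd in auto)
  ultimately show ?case by simp
qed

lemma Ck_on_SucD:
  assumes "Ck_on (Suc k) S f" "x \<in> S"
  shows "(f has_derivative frechet_derivative f (at x)) (at x)"
  using assms frechet_derivative_works by auto

text \<open>\<open>Ck_on\<close> refers to \<open>frechet_derivative\<close>, a choice operator;
  uniqueness of derivatives lets an explicit formula \<open>f'\<close> stand in for it on
  \<open>S\<close>.\<close>

lemma Ck_on_SucI:
  assumes "open S" "\<And>x. x \<in> S \<Longrightarrow> (f has_derivative f' x) (at x)"
    and "\<And>v. Ck_on k S (\<lambda>x. f' x v)"
  shows "Ck_on (Suc k) S f"
proof -
  have "f' x = frechet_derivative f (at x)" if "x \<in> S" for x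
    using assms(2)[OF that] by (rule frechet_derivative_at)
  then have "Ck_on k S (\<lambda>x. frechet_derivative f (at x) v)" for v
    by (intro Ck_on_cong[OF assms(1) _ assms(3)[of v]]) simp
  then show ?thesis using assms(2) by (auto intro: differentiableI)
qed

lemma Ck_on_Suc_imp:
  assumes "Ck_on (Suc k) S f" shows "Ck_on k S f"
  using assms
proof (induction k arbitrary: f)
  case 0
  then show ?case
    by (auto intro!: continuous_at_imp_continuous_on differentiable_imp_continuous_within)
next
  case (Suc k)
  then show ?case by (metis Ck_on.simps(2))
qed

lemma Ck_on_const: "open S \<Longrightarrow> Ck_on k S (\<lambda>x. c)"
proof (induction k arbitrary: c)
  case (Suc k)
  show ?case by (rule Ck_on_SucI[where f' = "\<lambda>x v. 0"]) (use Suc in auto)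
qed simp

lemma Ck_on_linear:
  assumes "open S" "bounded_linear f" shows "Ck_on k S f"
proof (cases k)
  case 0
  then show ?thesis using assms(2) by (simp add: linear_continuous_on)
next
  case (Suc n)
  show ?thesis unfolding Suc
    by (rule Ck_on_SucI[where f' = "\<lambda>x. f"])
      (use assms bounded_linear_imp_has_derivative Ck_on_const in auto)
qed

lemma Ck_on_add:
  assumes "open S" "Ck_on k S f" "Ck_on k S g"
  shows "Ck_on k S (\<lambda>x. f x + g x)"
  using assms(2,3)
proof (induction k arbitrary: f g)
  case 0
  then show ?case by (simp add: continuous_on_add)
next
  case (Suc k)
  show ?case
    by (rule Ck_on_SucI[OF assms(1) has_derivative_add[OF Ck_on_SucD Ck_on_SucD]])
      (use Suc in auto)
qed

lemma Ck_on_mult: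
  assumes "open S" "Ck_on k S f" "Ck_on k S g"
  shows "Ck_on k S (\<lambda>x. f x * g x)"
  using assms(2,3)
proof (induction k arbitrary: f g)
  case 0
  then show ?case by (simp add: continuous_on_mult)
next
  case (Suc k)
  \<comment> \<open>The product rule also contains \<open>f\<close> and \<open>g\<close>
    undifferentiated, so both are lowered to order \<open>k\<close> before the induction hypothesis
    is applied.\<close>
  have "Ck_on k S f" "Ck_on k S g" using Suc.prems Ck_on_Suc_imp by blast+
  then show ?case
    by (intro Ck_on_SucI[OF assms(1) has_derivative_mult[OF Ck_on_SucD Ck_on_SucD]])
      (use Suc assms(1) in \<open>auto intro!: Ck_on_add\<close>)
qed

lemma Ck_on_sum:
  assumes "open S" "\<And>i. i \<in> I \<Longrightarrow> Ck_on k S (f i)"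
  shows "Ck_on k S (\<lambda>x. \<Sum>i\<in>I. f i x)"
  using assms(2)
proof (induction I rule: infinite_finite_induct)
  case (insert i I)
  then show ?case using Ck_on_add[OF assms(1), of k "f i" "\<lambda>x. \<Sum>i\<in>I. f i x"] by auto
qed (use assms(1) Ck_on_const in auto)

text \<open>The derivative of \<open>1 / f\<close> contains \<open>1 / f\<close> itself, but only
  order \<open>k\<close> is asked of it there, which the induction hypothesis supplies.\<close>

lemma Ck_on_inverse:
  assumes "open S" "Ck_on k S f" "\<And>x. x \<in> S \<Longrightarrow> f x \<noteq> 0"
  shows "Ck_on k S (\<lambda>x. inverse (f x))"
  using assms(2,3)
proof (induction k arbitrary: f)
  case 0
  then show ?case by (simp add: continuous_on_inverse)
next
  case (Suc k)
  have i: "Ck_on k S (\<lambda>x. inverse (f x))" using Suc Ck_on_Suc_imp by blast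
  have d: "Ck_on k S (\<lambda>x. frechet_derivative f (at x) v)" for v using Suc.prems by simp
  show ?case
  proof (rule Ck_on_SucI[OF assms(1) Deriv.has_derivative_inverse[OF Suc.prems(2) Ck_on_SucD[OF Suc.prems(1)]]])
    fix v
    have "Ck_on k S (\<lambda>x. (- 1) * (inverse (f x) * frechet_derivative f (at x) v * inverse (f x)))"
      by (intro Ck_on_mult Ck_on_const assms(1) i d)
    then show "Ck_on k S (\<lambda>x. - (inverse (f x) * frechet_derivative f (at x) v * inverse (f x)))"
      by simp
  qed
qed

text \<open>Chain rule in coordinates: a directional derivative of the composite is a sum of
  products of derivatives of components of \<open>g\<close> with partial derivatives of
  \<open>f\<close> composed with \<open>g\<close>. The induction is over all \<open>f\<close>, so it
  covers these partial derivatives. The map \<open>g\<close> enters componentwise because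
  \<open>Ck_on\<close> is about real-valued functions.\<close>

lemma Ck_on_compose:
  fixes g :: "'a::euclidean_space \<Rightarrow> 'b::euclidean_space"
  assumes "open S" "open T" "Ck_on k T f" "\<And>b. b \<in> Basis \<Longrightarrow> Ck_on k S (\<lambda>x. g x \<bullet> b)"
    and "\<And>x. x \<in> S \<Longrightarrow> g x \<in> T"
  shows "Ck_on k S (\<lambda>x. f (g x))"
  using assms(3,4)
proof (induction k arbitrary: f)
  case 0
  have "continuous_on S g"
    using 0 by (simp add: continuous_on_componentwise[of S g])
  then show ?case using 0 continuous_on_compose2[of T f S g] assms(5) by auto
next
  case (Suc k)
  define g' where "g' x v = (\<Sum>b\<in>Basis. frechet_derivative (\<lambda>x. g x \<bullet> b) (at x) v *\<^sub>R b)" for x v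
  have dg: "(g has_derivative g' x) (at x)" if "x \<in> S" for x
  proof -
    have "((\<lambda>x. g x \<bullet> b) has_derivative (\<lambda>v. g' x v \<bullet> b)) (at x)" if "b \<in> Basis" for b
      using Ck_on_SucD[OF Suc.prems(2)[OF that] \<open>x \<in> S\<close>] that by (simp add: g'_def)
    then show ?thesis
      using has_derivative_componentwise_within[of g "g' x" x UNIV] by blast
  qed
  have df: "(f has_derivative frechet_derivative f (at y)) (at y)" if "y \<in> T" for y
    using Ck_on_SucD Suc.prems(1) that by blast
  have chain: "((\<lambda>x. f (g x)) has_derivative
      (\<lambda>v. \<Sum>b\<in>Basis. frechet_derivative (\<lambda>x. g x \<bullet> b) (at x) v * frechet_derivative f (at (g x)) b)) (at x)"
    if "x \<in> S" for x
  proof -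
    have lin: "linear (frechet_derivative f (at (g x)))"
      using df[OF assms(5)[OF that]] has_derivative_linear by blast
    have "frechet_derivative f (at (g x)) (g' x v) =
      (\<Sum>b\<in>Basis. frechet_derivative (\<lambda>x. g x \<bullet> b) (at x) v * frechet_derivative f (at (g x)) b)" for v
      by (simp add: g'_def linear_sum[OF lin] linear_cmul[OF lin])
    then show ?thesis
      using has_derivative_compose[OF dg[OF that] df[OF assms(5)[OF that]]] by simp
  qed
  show ?case
  proof (rule Ck_on_SucI[OF assms(1) chain])
    fix v
    have "Ck_on k S (\<lambda>x. frechet_derivative (\<lambda>x. g x \<bullet> b) (at x) v)" if "b \<in> Basis" for b
      using Suc.prems(2)[OF that] by simp
    moreover have "Ck_on k S (\<lambda>x. frechet_derivative f (at (g x)) b)" for b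
      using Suc.IH[of "\<lambda>y. frechet_derivative f (at y) b"] Suc.prems Ck_on_Suc_imp[of k] by (metis Ck_on.simps(2))
    ultimately show "Ck_on k S (\<lambda>x. \<Sum>b\<in>Basis. frechet_derivative (\<lambda>x. g x \<bullet> b) (at x) v *
        frechet_derivative f (at (g x)) b)"
      by (intro Ck_on_sum Ck_on_mult assms(1))
  qed
qed

section \<open>Closure properties passed from \<open>C\<^sup>k\<close> to smooth functions\<close>

lemma smooth_on_const: "open S \<Longrightarrow> smooth_on S (\<lambda>x. c)"
  by (simp add: smooth_on_def Ck_on_const)

lemma smooth_on_linear: "open S \<Longrightarrow> bounded_linear f \<Longrightarrow> smooth_on S f"
  by (simp add: smooth_on_def Ck_on_linear)

lemma smooth_on_add: "open S \<Longrightarrow> smooth_on S f \<Longrightarrow> smooth_on S g \<Longrightarrow> smooth_on S (\<lambda>x. f x + g x)"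
  by (simp add: smooth_on_def Ck_on_add)

lemma smooth_on_mult: "open S \<Longrightarrow> smooth_on S f \<Longrightarrow> smooth_on S g \<Longrightarrow> smooth_on S (\<lambda>x. f x * g x)"
  by (simp add: smooth_on_def Ck_on_mult)

lemma smooth_on_diff:
  assumes "open S" "smooth_on S f" "smooth_on S g"
  shows "smooth_on S (\<lambda>x. f x - g x)"
  using smooth_on_add[OF assms(1,2) smooth_on_mult[OF assms(1) smooth_on_const[OF assms(1), of "- 1"] assms(3)]]
  by simp

lemma smooth_on_power: "open S \<Longrightarrow> smooth_on S f \<Longrightarrow> smooth_on S (\<lambda>x. f x ^ n)"
  by (induction n) (simp_all add: smooth_on_mult smooth_on_const)

lemma smooth_on_compose:
  fixes g :: "'a::euclidean_space \<Rightarrow> 'b::euclidean_space"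
  assumes "open S" "open T" "smooth_on T f" "\<And>b. b \<in> Basis \<Longrightarrow> smooth_on S (\<lambda>x. g x \<bullet> b)"
    and "\<And>x. x \<in> S \<Longrightarrow> g x \<in> T"
  shows "smooth_on S (\<lambda>x. f (g x))"
  unfolding smooth_on_def
proof
  fix k
  show "Ck_on k S (\<lambda>x. f (g x))"
    by (rule Ck_on_compose[OF assms(1,2) _ _ assms(5)]) (use assms(3,4) in \<open>auto simp: smooth_on_def\<close>)
qed

lemma smooth_on_compose_vec:
  fixes g :: "'a::euclidean_space \<Rightarrow> real ^ 'n"
  assumes "open S" "open T" "smooth_on T f" "\<And>i. smooth_on S (\<lambda>x. g x $ i)"
    and "\<And>x. x \<in> S \<Longrightarrow> g x \<in> T"
  shows "smooth_on S (\<lambda>x. f (g x))"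
proof (rule smooth_on_compose[OF assms(1-3) _ assms(5)])
  fix b :: "real ^ 'n" assume "b \<in> Basis"
  then obtain i where "b = axis i 1" by (auto simp: Basis_vec_def)
  then show "smooth_on S (\<lambda>x. g x \<bullet> b)" using assms(4) by (simp add: inner_axis)
qed

lemma smooth_on_has_derivative:
  "smooth_on S f \<Longrightarrow> x \<in> S \<Longrightarrow> (f has_derivative frechet_derivative f (at x)) (at x)"
  by (rule Ck_on_SucD[where k = 0 and S = S]) (simp_all only: smooth_on_def)

lemma smooth_on_frechet_derivative:
  "smooth_on S f \<Longrightarrow> smooth_on S (\<lambda>x. frechet_derivative f (at x) v)"
  by (metis smooth_on_def Ck_on.simps(2))

lemma smooth_on_imp_continuous_on: "smooth_on S f \<Longrightarrow> continuous_on S f"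
  by (metis smooth_on_def Ck_on.simps(1))

subsection \<open>The smooth implicit function theorem\<close>

text \<open>Smoothness bootstraps: if \<open>t\<close> is \<open>C\<^sup>k\<close>, then the formula for its derivative is \<open>C\<^sup>k\<close> too.\<close>

lemma smooth_on_implicit:
  fixes H :: "'a::euclidean_space \<times> real \<Rightarrow> real"
  assumes "open U" "open S" "smooth_on S H"
    and HS: "\<And>x. x \<in> U \<Longrightarrow> (x, t x) \<in> S"
    and H0: "\<And>x. x \<in> U \<Longrightarrow> H (x, t x) = 0"
    and nz: "\<And>x. x \<in> U \<Longrightarrow> frechet_derivative H (at (x, t x)) (0, 1) \<noteq> 0"
    and tdiff: "\<And>x. x \<in> U \<Longrightarrow> t differentiable (at x)"
  shows "smooth_on U t"
proof -
  let ?D = "\<lambda>x v. frechet_derivative H (at (x, t x)) v"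
  \<comment> \<open>Implicit differentiation, written with a factor \<open>- 1\<close> and
    \<open>inverse\<close> to match the closure rules for \<open>Ck_on\<close>.\<close>
  define t' where "t' x v = (- 1) * (?D x (v, 0) * inverse (?D x (0, 1)))" for x v
  have t': "(t has_derivative t' x) (at x)" if x: "x \<in> U" for x
  proof -
    obtain L where L: "(t has_derivative L) (at x)" using tdiff[OF x] unfolding differentiable_def by blast
    have DH: "(H has_derivative ?D x) (at (x, t x))"
      using smooth_on_has_derivative[OF assms(3) HS[OF x]] .
    then have lin: "linear (?D x)" using has_derivative_linear by blast
    have "((\<lambda>x. (x, t x)) has_derivative (\<lambda>v. (v, L v))) (at x)"
      by (intro has_derivative_Pair has_derivative_ident L)
    from has_derivative_compose[OF this DH]
    have "((\<lambda>x. H (x, t x)) has_derivative (\<lambda>v. ?D x (v, L v))) (at x)" .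
    \<comment> \<open>The composite vanishes on the open set \<open>U\<close>, so its derivative is
      zero; comparison with the chain rule determines \<open>L\<close>.\<close>
    moreover have "((\<lambda>x. H (x, t x)) has_derivative (\<lambda>v. 0)) (at x)"
      by (rule has_derivative_transform_within_open[OF has_derivative_const[of 0] assms(1) x])
        (use H0 in auto)
    ultimately have "(\<lambda>v. ?D x (v, L v)) = (\<lambda>v. 0)" by (rule has_derivative_unique)
    then have z: "?D x (v, L v) = 0" for v by metis
    have "?D x (v, L v) = ?D x (v, 0) + L v * ?D x (0, 1)" for v
      using linear_add[OF lin, of "(v, 0)" "L v *\<^sub>R (0, 1)"] linear_cmul[OF lin, of "L v" "(0, 1)"]
      by simp
    then have "L v = t' x v" for v
      using z[of v] nz[OF x] unfolding t'_def by (simp add: field_simps)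
    then have "L = t' x" by blast
    then show ?thesis using L by simp
  qed
  have "Ck_on k U t" for k
  proof (induction k)
    case 0
    have "continuous_on U t"
      using tdiff by (meson continuous_at_imp_continuous_on differentiable_imp_continuous_within)
    then show ?case by simp
  next
    case (Suc k)
    \<comment> \<open>The derivatives of \<open>H\<close> are taken along the graph of
      \<open>t\<close>, so their regularity in \<open>x\<close> comes from the induction hypothesis
      on \<open>t\<close>.\<close>
    have comp: "Ck_on k U (\<lambda>x. ?D x w)" for w
    proof (rule Ck_on_compose[OF assms(1,2)])
      show "Ck_on k S (\<lambda>z. frechet_derivative H (at z) w)"
        using smooth_on_frechet_derivative[OF assms(3)] by (simp add: smooth_on_def)
      fix b :: "'a \<times> real" assume "b \<in> Basis"
      then consider "\<exists>u. b = (u, 0)" | "b = (0, 1)" by (auto simp: Basis_prod_def)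
      then show "Ck_on k U (\<lambda>x. (x, t x) \<bullet> b)"
      proof cases
        case 1
        then show ?thesis using Ck_on_linear[OF assms(1) bounded_linear_inner_left] by auto
      next
        case 2
        then show ?thesis using Suc by simp
      qed
    qed (use HS in auto)
    show ?case
    proof (rule Ck_on_SucI[OF assms(1) t'])
      show "Ck_on k U (\<lambda>x. t' x v)" for v
        unfolding t'_def
        by (intro Ck_on_mult Ck_on_const Ck_on_inverse comp assms(1) nz)
    qed
  qed
  then show ?thesis by (simp add: smooth_on_def)
qed

text \<open>The inverse function theorem is applied to \<open>f (x, r) = (x, H (x, r))\<close>,
  whose local inverse sends \<open>(x, 0)\<close> to \<open>(x, t x)\<close>. This yields a
  differentiable \<open>t\<close>, which \<open>smooth_on_implicit\<close> upgrades to a smooth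
  one.\<close>

lemma smooth_implicit_function:
  fixes H :: "'a::euclidean_space \<times> real \<Rightarrow> real"
  assumes "open S" "smooth_on S H" "(p, s) \<in> S" "H (p, s) = 0"
    and nz: "frechet_derivative H (at (p, s)) (0, 1) \<noteq> 0"
  obtains U V t where "open U" "p \<in> U" "open V" "s \<in> V" "U \<times> V \<subseteq> S" "smooth_on U t" "t p = s"
    "\<And>x. x \<in> U \<Longrightarrow> t x \<in> V" "\<And>x r. x \<in> U \<Longrightarrow> r \<in> V \<Longrightarrow> H (x, r) = 0 \<longleftrightarrow> r = t x"
proof -
  let ?D = "\<lambda>z. frechet_derivative H (at z)"
  define f where "f z = (fst z, H z)" for z
  define f' where "f' z = Blinfun (\<lambda>v. (fst v, ?D z v))" for z
  \<comment> \<open>The inverse of \<open>(v, r) \<mapsto> (v, D (v, 0) + r * D (0, 1))\<close>,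
    with \<open>D\<close> the derivative at \<open>(p, s)\<close>, found by solving for
    \<open>r\<close>; \<open>nz\<close> permits the division.\<close>
  define invf where "invf = Blinfun (\<lambda>w. (fst w, (snd w - ?D (p, s) (fst w, 0)) / ?D (p, s) (0, 1)))"
  have DH: "(H has_derivative ?D z) (at z)" if "z \<in> S" for z
    using smooth_on_has_derivative[OF assms(2) that] .
  have bl: "bounded_linear (?D z)" if "z \<in> S" for z
    using DH[OF that] has_derivative_bounded_linear by blast
  have app_f': "blinfun_apply (f' z) = (\<lambda>v. (fst v, ?D z v))" if "z \<in> S" for z
    unfolding f'_def
    by (intro bounded_linear_Blinfun_apply bounded_linear_Pair bounded_linear_fst bl that)
  have derf: "(f has_derivative blinfun_apply (f' z)) (at z)" if "z \<in> S" for z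
    unfolding app_f'[OF that] f_def
    by (intro has_derivative_Pair has_derivative_fst has_derivative_ident DH that)
  have contf: "continuous_on S f'"
  proof (rule continuous_on_blinfun_componentwise)
    fix i :: "'a \<times> real"
    have "continuous_on S (\<lambda>z. (fst i, ?D z i))"
      by (intro continuous_intros smooth_on_imp_continuous_on smooth_on_frechet_derivative assms(2))
    then show "continuous_on S (\<lambda>z. blinfun_apply (f' z) i)"
      by (rule continuous_on_eq) (simp add: app_f')
  qed
  have "bounded_linear (\<lambda>w. ?D (p, s) (fst w, 0))"
    by (rule bounded_linear_compose[OF bl[OF assms(3)]])
      (intro bounded_linear_Pair bounded_linear_fst bounded_linear_zero)
  then have app_invf: "blinfun_apply invf = (\<lambda>w. (fst w, (snd w - ?D (p, s) (fst w, 0)) / ?D (p, s) (0, 1)))"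
    unfolding invf_def
    by (intro bounded_linear_Blinfun_apply bounded_linear_Pair bounded_linear_fst
        bounded_linear_divide[THEN bounded_linear_compose] bounded_linear_sub bounded_linear_snd)
  have split: "?D z (v, r) = ?D z (v, 0) + r * ?D z (0, 1)" if "z \<in> S" for z v r
  proof -
    have lin: "linear (?D z)" using bl[OF that] bounded_linear.linear by blast
    show ?thesis
      using linear_add[OF lin, of "(v, 0)" "r *\<^sub>R (0, 1)"] linear_cmul[OF lin, of r "(0, 1)"] by simp
  qed
  have "invf o\<^sub>L f' (p, s) = id_blinfun"
  proof (rule blinfun_eqI)
    fix w :: "'a \<times> real"
    show "blinfun_apply (invf o\<^sub>L f' (p, s)) w = blinfun_apply id_blinfun w"
      using nz split[OF assms(3), of "fst w" "snd w"]
      by (simp add: app_invf app_f'[OF assms(3)] prod_eq_iff)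
  qed
  from inverse_function_theorem[OF assms(1) derf contf assms(3) this]
  obtain U' V' g g' where IF: "open U'" "U' \<subseteq> S" "(p, s) \<in> U'" "open V'" "f (p, s) \<in> V'" "homeomorphism U' V' f g"
    and dg: "\<And>y. y \<in> V' \<Longrightarrow> (g has_derivative g' y) (at y)"
    and bij: "\<And>y. y \<in> V' \<Longrightarrow> bij (blinfun_apply (f' (g y)))"
    by metis
  \<comment> \<open>In a box inside \<open>U'\<close>, where \<open>f\<close> is injective, a zero
    \<open>(x, r)\<close> of \<open>H\<close> must be \<open>g (x, 0)\<close>.\<close>
  obtain A V where AV: "open A" "open V" "(p, s) \<in> A \<times> V" "A \<times> V \<subseteq> U'"
    using open_prod_elim[OF IF(1,3)] by metis
  define t where "t x = snd (g (x, 0))" for x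
  define Z where "Z = {x. (x, 0) \<in> V'}"
  have "open Z"
    unfolding Z_def using open_vimage[OF IF(4), of "\<lambda>x. (x, 0)"] 
    by (simp add: vimage_def continuous_on_Pair)
  have dt: "t differentiable (at x)" if "x \<in> Z" for x
  proof -
    have "((\<lambda>x. (x, 0::real)) has_derivative (\<lambda>v. (v, 0))) (at x)"
      by (intro has_derivative_Pair has_derivative_ident has_derivative_const)
    from has_derivative_compose[OF this dg[of "(x, 0)"]]
    show ?thesis using that unfolding t_def Z_def
      by (auto intro: differentiableI has_derivative_snd)
  qed
  then have "continuous_on Z t"
    by (meson continuous_at_imp_continuous_on differentiable_imp_continuous_within)
  \<comment> \<open>Restricting to the preimage of \<open>V\<close> keeps the graph of
    \<open>t\<close> inside the box.\<close>
  define U where "U = A \<inter> (Z \<inter> t -` V)"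
  have "open U"
    unfolding U_def using \<open>open Z\<close> \<open>continuous_on Z t\<close> AV continuous_open_preimage by blast
  have g: "g (x, 0) = (x, t x)" and ft: "H (x, t x) = 0" if "x \<in> Z" for x
  proof -
    have "f (g (x, 0)) = (x, 0)"
      using IF(6) that unfolding Z_def homeomorphism_def by auto
    then have "fst (g (x, 0)) = x" "H (g (x, 0)) = 0" unfolding f_def by auto
    then show "g (x, 0) = (x, t x)" "H (x, t x) = 0"
      unfolding t_def by (metis prod.collapse)+
  qed
  have gS: "g y \<in> S" if "y \<in> V'" for y using IF(2,6) that unfolding homeomorphism_def by blast
  have gr: "r = t x" if "(x, r) \<in> U'" "H (x, r) = 0" for x r
  proof -
    have "g (f (x, r)) = (x, r)" using IF(6) that unfolding homeomorphism_def by blast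
    then show ?thesis unfolding f_def t_def using that by simp
  qed
  have "p \<in> Z" using IF(5) assms(4) by (simp add: Z_def f_def)
  have "t p = s" using gr[OF IF(3) assms(4)] by simp
  have "smooth_on U t"
  proof (rule smooth_on_implicit[OF \<open>open U\<close> assms(1,2)])
    fix x assume "x \<in> U"
    then have "x \<in> Z" by (simp add: U_def)
    then show "H (x, t x) = 0" "t differentiable (at x)" by (fact ft, fact dt)
    have V': "(x, 0) \<in> V'" using \<open>x \<in> Z\<close> by (simp add: Z_def)
    show S: "(x, t x) \<in> S" using gS[OF V'] g[OF \<open>x \<in> Z\<close>] by simp
    \<comment> \<open>Injectivity carries the nonvanishing from \<open>(p, s)\<close> to the whole
      graph: otherwise \<open>(0, 1)\<close> would lie in the kernel.\<close>
    have "inj (blinfun_apply (f' (x, t x)))"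
      using bij[OF V'] g[OF \<open>x \<in> Z\<close>] by (simp add: bij_def)
    from inj_eq[OF this, of "(0, 1)" 0]
    have "blinfun_apply (f' (x, t x)) (0, 1) \<noteq> 0"
      by (simp only: blinfun.zero_right) (simp add: prod_eq_iff)
    then show "?D (x, t x) (0, 1) \<noteq> 0"
      by (simp add: app_f'[OF S] prod_eq_iff)
  qed
  show thesis
  proof (rule that[OF \<open>open U\<close> _ AV(2) _ _ \<open>smooth_on U t\<close> \<open>t p = s\<close>])
    show "p \<in> U" using \<open>p \<in> Z\<close> \<open>t p = s\<close> AV(3) by (simp add: U_def)
    show "s \<in> V" using AV(3) by simp
    show "U \<times> V \<subseteq> S" using AV(4) IF(2) by (auto simp: U_def)
    show "t x \<in> V" if "x \<in> U" for x using that by (simp add: U_def)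
    show "H (x, r) = 0 \<longleftrightarrow> r = t x" if "x \<in> U" "r \<in> V" for x r
      using that gr[of x r] ft[of x] AV(4) by (auto simp: U_def)
  qed
qed

subsection \<open>Characteristic curves\<close>

lemma exhaust_5:
  fixes i :: 5
  shows "i = 0 \<or> i = 1 \<or> i = 2 \<or> i = 3 \<or> i = 4"
proof (induct i)
  case (of_int z)
  then have "z = 0 \<or> z = 1 \<or> z = 2 \<or> z = 3 \<or> z = 4" by fastforce
  then show ?case by auto
qed

lemma forall_5: "(\<forall>i::5. P i) \<longleftrightarrow> P 0 \<and> P 1 \<and> P 2 \<and> P 3 \<and> P 4"
  by (metis exhaust_5)

lemma F_args_nth:
  "F_args x s $ 0 = x $ 0 + x $ 1 * x $ 4 + 3 * s * x $ 2 * x $ 4 - s ^ 3 * (x $ 4) ^ 2"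
  "F_args x s $ 1 = x $ 1 + s ^ 3 * x $ 4"
  "F_args x s $ 2 = x $ 2 - s ^ 2 * x $ 4"
  "F_args x s $ 3 = x $ 3 + s * x $ 4"
  "F_args x s $ 4 = s"
  by (simp_all add: F_args_def)

section \<open>The characteristic flow for a fixed value \<open>s\<close>\<close>

definition char_dir :: "real \<Rightarrow> real ^ 5 \<Rightarrow> real ^ 5" where
  "char_dir s x = - (x $ 1 + 3 * s * x $ 2) *\<^sub>R axis 0 1 - s ^ 3 *\<^sub>R axis 1 1
     + s ^ 2 *\<^sub>R axis 2 1 - s *\<^sub>R axis 3 1 + axis 4 1"

text \<open>Along an integral curve only the 0-component of \<open>char_dir s\<close> varies:
  \<open>x $ 1 + 3 * s * x $ 2\<close> grows at rate \<open>2 * s ^ 3\<close>, which integrates to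
  the quadratic correction.\<close>

definition flow :: "real \<Rightarrow> real ^ 5 \<Rightarrow> real \<Rightarrow> real ^ 5" where
  "flow s x \<tau> = x + \<tau> *\<^sub>R char_dir s x - (s ^ 3 * \<tau> ^ 2) *\<^sub>R axis 0 1"

lemma flow_nth:
  "flow s x \<tau> $ 0 = x $ 0 - (x $ 1 + 3 * s * x $ 2) * \<tau> - s ^ 3 * \<tau> ^ 2"
  "flow s x \<tau> $ 1 = x $ 1 - s ^ 3 * \<tau>"
  "flow s x \<tau> $ 2 = x $ 2 + s ^ 2 * \<tau>"
  "flow s x \<tau> $ 3 = x $ 3 - s * \<tau>"
  "flow s x \<tau> $ 4 = x $ 4 + \<tau>"
  by (simp_all add: flow_def char_dir_def axis_def algebra_simps)

text \<open>The entries of \<open>F_args\<close> are first integrals of the flow with the same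
  \<open>s\<close>; this is a polynomial identity.\<close>

lemma F_args_flow: "F_args (flow s x \<tau>) s = F_args x s"
  by (simp add: vec_eq_iff forall_5 F_args_nth flow_nth algebra_simps power2_eq_square power3_eq_cube)

lemma flow_0 [simp]: "flow s x 0 = x"
  by (simp add: flow_def)

lemma flow_has_vector_derivative:
  "(flow s x has_vector_derivative char_dir s (flow s x \<tau>)) (at \<tau> within T)"
proof -
  have "char_dir s (flow s x \<tau>) = char_dir s x - (s ^ 3 * (2 * \<tau>)) *\<^sub>R axis 0 1"
    unfolding char_dir_def flow_nth by (simp add: algebra_simps power2_eq_square power3_eq_cube)
  moreover have "(flow s x has_vector_derivative char_dir s x - (s ^ 3 * (2 * \<tau>)) *\<^sub>R axis 0 1) (at \<tau> within T)"
    unfolding flow_def[abs_def] by (auto intro!: derivative_eq_intros)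
  ultimately show ?thesis by simp
qed

lemma continuous_on_flow: "continuous_on T (flow s x)"
  unfolding flow_def[abs_def] by (intro continuous_intros)

text \<open>Links the flow to the PDE. The parameter \<open>s\<close> is independent of
  \<open>t x\<close>, so the formula also serves where \<open>t x = s\<close> is still to be
  proved.\<close>

lemma frechet_derivative_char_dir:
  assumes "t differentiable (at x)"
  shows "frechet_derivative t (at x) (char_dir s x) =
    - ((x $ 1 + 3 * s * x $ 2) * partial 0 t x + s ^ 3 * partial 1 t x
      - s ^ 2 * partial 2 t x + s * partial 3 t x - partial 4 t x)"
proof -
  have lin: "linear (frechet_derivative t (at x))"
    using assms by (rule linear_frechet_derivative)
  show ?thesis
    unfolding char_dir_def partial_def
    by (simp add: linear_add[OF lin] linear_diff[OF lin] linear_cmul[OF lin] linear_neg[OF lin] algebra_simps)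
qed

lemma has_derivative_along_flow:
  assumes "t differentiable (at (flow s x \<tau>))"
  shows "((\<lambda>\<tau>. t (flow s x \<tau>)) has_real_derivative
    frechet_derivative t (at (flow s x \<tau>)) (char_dir s (flow s x \<tau>))) (at \<tau> within T)"
proof -
  have "(t has_derivative frechet_derivative t (at (flow s x \<tau>))) (at (flow s x \<tau>))"
    using assms by (simp add: frechet_derivative_works)
  from vector_derivative_diff_chain_within[OF flow_has_vector_derivative has_derivative_at_withinI[OF this]]
  show ?thesis
    by (simp add: has_real_derivative_iff_has_vector_derivative o_def)
qed

text \<open>Differentiating along the curve at time 0 gives the PDE at \<open>p\<close>, because the
  parameter of the curve is \<open>t p\<close> itself.\<close>

lemma solves_pde_if_constant_along_flow:
  assumes "t differentiable (at p)"
    and "\<forall>\<^sub>F \<tau> in nhds 0. t (flow (t p) p \<tau>) = t p"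
  shows "(p $ 1 + 3 * t p * p $ 2) * partial 0 t p + t p ^ 3 * partial 1 t p
             - t p ^ 2 * partial 2 t p + t p * partial 3 t p - partial 4 t p = 0"
proof -
  let ?u = "\<lambda>\<tau>. t (flow (t p) p \<tau>)"
  have "(?u has_real_derivative frechet_derivative t (at p) (char_dir (t p) p)) (at 0)"
    using has_derivative_along_flow[of t "t p" p 0 UNIV] assms(1) by simp
  moreover have "(?u has_real_derivative 0) (at 0)"
    using DERIV_cong_ev[OF refl assms(2) refl] by simp
  ultimately have "frechet_derivative t (at p) (char_dir (t p) p) = 0"
    using DERIV_unique by blast
  then show ?thesis using frechet_derivative_char_dir[OF assms(1)] by simp
qed

text \<open>Multiplying by the integrating factor \<open>exp (- A)\<close> makes \<open>u\<close>
  constant, and the constant is 0 at \<open>c\<close>. The base point may lie anywhere in the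
  interval, so zeros propagate in both directions.\<close>

lemma linear_ode_zero:
  fixes u a :: "real \<Rightarrow> real"
  assumes "continuous_on {l..r} a"
    and "\<And>\<tau>. \<tau> \<in> {l..r} \<Longrightarrow> (u has_real_derivative a \<tau> * u \<tau>) (at \<tau> within {l..r})"
    and "c \<in> {l..r}" "u c = 0" "\<tau> \<in> {l..r}"
  shows "u \<tau> = 0"
proof -
  define A where "A \<tau> = integral {l..\<tau>} a" for \<tau>
  have A: "(A has_real_derivative a \<tau>) (at \<tau> within {l..r})" if "\<tau> \<in> {l..r}" for \<tau>
    unfolding A_def using integral_has_real_derivative[OF assms(1) that] .
  have "((\<lambda>\<tau>. u \<tau> * exp (- A \<tau>)) has_real_derivative 0) (at \<tau> within {l..r})" if "\<tau> \<in> {l..r}" for \<tau>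
    by (rule derivative_eq_intros assms(2)[OF that] A[OF that] refl | simp)+
  then have "\<exists>k. \<forall>\<tau>\<in>{l..r}. u \<tau> * exp (- A \<tau>) = k"
    by (rule has_field_derivative_zero_constant[OF convex_real_interval(5)])
  then obtain k where k: "\<And>\<tau>. \<tau> \<in> {l..r} \<Longrightarrow> u \<tau> * exp (- A \<tau>) = k"
    by blast
  show ?thesis using k[OF assms(3)] k[OF assms(5)] assms(4) by simp
qed

text \<open>Along a curve of the flow, the deviation of \<open>t\<close> from \<open>s\<close> satisfies a homogeneous linear ODE.\<close>

lemma solution_constant_along_flow:
  assumes "smooth_on U t" "solves_pde_on U t"
    and U: "\<And>\<tau>. \<tau> \<in> {l..r} \<Longrightarrow> flow s x \<tau> \<in> U"
    and "c \<in> {l..r}" "t (flow s x c) = s" "\<tau> \<in> {l..r}"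
  shows "t (flow s x \<tau>) = s"
proof -
  \<comment> \<open>Subtracting the PDE expression with \<open>s\<close> in its coefficients from
    the one with \<open>t y\<close> leaves differences of powers; \<open>b\<close> is what remains
    after the common factor \<open>t y - s\<close> is taken out.\<close>
  define b where "b y = 3 * y $ 2 * partial 0 t y + (t y ^ 2 + t y * s + s ^ 2) * partial 1 t y
    - (t y + s) * partial 2 t y + partial 3 t y" for y
  have "t (flow s x \<tau>) - s = 0"
  proof (rule linear_ode_zero[where a = "\<lambda>\<tau>. b (flow s x \<tau>)" and c = c and l = l and r = r
        and u = "\<lambda>\<tau>. t (flow s x \<tau>) - s"])
    have "continuous_on U t" "continuous_on U (partial i t)" for i
      using smooth_on_imp_continuous_on[OF smooth_on_frechet_derivative[OF assms(1)]]
        smooth_on_imp_continuous_on[OF assms(1)] by (simp_all add: partial_def[abs_def])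
    then have "continuous_on U b"
      unfolding b_def[abs_def] by (intro continuous_intros)
    then show "continuous_on {l..r} (\<lambda>\<tau>. b (flow s x \<tau>))"
      by (rule continuous_on_compose2[OF _ continuous_on_flow]) (use U in auto)
    fix \<tau> assume "\<tau> \<in> {l..r}"
    define y where "y = flow s x \<tau>"
    have y: "y \<in> U" using U[OF \<open>\<tau> \<in> {l..r}\<close>] by (simp add: y_def)
    have dt: "t differentiable (at y)"
      using smooth_on_has_derivative[OF assms(1) y] by (rule differentiableI)
    have "(y $ 1 + 3 * t y * y $ 2) * partial 0 t y + t y ^ 3 * partial 1 t y
             - t y ^ 2 * partial 2 t y + t y * partial 3 t y - partial 4 t y = 0"
      using assms(2) y by (simp add: solves_pde_on_def)
    then have "frechet_derivative t (at y) (char_dir s y) = b y * (t y - s)"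
      unfolding frechet_derivative_char_dir[OF dt] b_def by algebra
    then show "((\<lambda>\<tau>. t (flow s x \<tau>) - s) has_real_derivative
        b (flow s x \<tau>) * (t (flow s x \<tau>) - s)) (at \<tau> within {l..r})"
      using has_derivative_along_flow[OF dt[unfolded y_def], of "{l..r}"]
      by (auto intro!: derivative_eq_intros simp: y_def)
  qed (use assms in auto)
  then show ?thesis by simp
qed

subsection \<open>Solutions of the PDE and solutions of the equation\<close>

text \<open>On the curve through \<open>p\<close> with \<open>s = t p\<close> the arguments of
  \<open>F\<close> do not change, so the equation stays satisfied by \<open>t p\<close>; the graph
  property then forces \<open>t\<close> to keep this value.\<close>

lemma solves_pde_if_obtained_by_solving:
  assumes "smooth_on U t" "\<And>p. p \<in> U \<Longrightarrow> obtained_by_solving_near W F U t p"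
  shows "solves_pde_on U t"
  unfolding solves_pde_on_def
proof
  fix p assume "p \<in> U"
  obtain N where N: "open N" "(p, t p) \<in> N"
    and eq: "\<And>x s. (x, s) \<in> N \<Longrightarrow> F (F_args x s) = 0 \<longleftrightarrow> s = t x"
    using assms(2)[OF \<open>p \<in> U\<close>] unfolding obtained_by_solving_near_def by blast
  \<comment> \<open>Only the first component moves; openness of \<open>N\<close> keeps the pair
    inside for small times.\<close>
  have "open ((\<lambda>\<tau>. (flow (t p) p \<tau>, t p)) -` N)"
    by (intro open_vimage N(1) continuous_intros continuous_on_flow)
  from eventually_nhds_in_open[OF this, of 0]
  have "\<forall>\<^sub>F \<tau> in nhds 0. (flow (t p) p \<tau>, t p) \<in> N"
    using N(2) by simp
  then have "\<forall>\<^sub>F \<tau> in nhds 0. t (flow (t p) p \<tau>) = t p"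
  proof eventually_elim
    case (elim \<tau>)
    have "F (F_args (flow (t p) p \<tau>) (t p)) = 0"
      using eq[OF N(2)] by (simp add: F_args_flow)
    then show ?case using eq[OF elim] by simp
  qed
  then show "(p $ 1 + 3 * t p * p $ 2) * partial 0 t p + t p ^ 3 * partial 1 t p
             - t p ^ 2 * partial 2 t p + t p * partial 3 t p - partial 4 t p = 0"
    using solves_pde_if_constant_along_flow
      differentiableI[OF smooth_on_has_derivative[OF assms(1) \<open>p \<in> U\<close>]] by blast
qed

text \<open>The point with \<open>x\<^sup>4 = c\<close> on the curve of the flow along which \<open>F_args\<close> takes the value \<open>y\<close>.\<close>

definition slice_point :: "real \<Rightarrow> real ^ 5 \<Rightarrow> real ^ 5" where
  "slice_point c y = flow (y $ 4) (y - y $ 4 *\<^sub>R axis 4 1) c"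

lemma slice_point_nth:
  "slice_point c y $ 0 = y $ 0 - (y $ 1 + 3 * y $ 4 * y $ 2) * c - y $ 4 ^ 3 * c ^ 2"
  "slice_point c y $ 1 = y $ 1 - y $ 4 ^ 3 * c"
  "slice_point c y $ 2 = y $ 2 + y $ 4 ^ 2 * c"
  "slice_point c y $ 3 = y $ 3 - y $ 4 * c"
  "slice_point c y $ 4 = c"
  by (simp_all add: slice_point_def flow_nth axis_def)

text \<open>At \<open>x $ 4 = 0\<close> the first four entries of \<open>F_args x s\<close> are the
  coordinates of \<open>x\<close>, which is why \<open>slice_point\<close> starts there. Starting
  from \<open>x\<close> instead, the slice is reached after time \<open>c - x $ 4\<close>.\<close>

lemma slice_point_F_args: "slice_point c (F_args x s) = flow s x (c - x $ 4)"
  by (simp add: vec_eq_iff forall_5 slice_point_nth F_args_nth flow_nth algebra_simps power2_eq_square power3_eq_cube)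

lemma smooth_on_nth: "open S \<Longrightarrow> smooth_on S (\<lambda>x. x $ i)"
  by (simp add: smooth_on_linear bounded_linear_vec_nth)

lemmas smooth_on_intros = smooth_on_const smooth_on_add smooth_on_mult smooth_on_diff smooth_on_power

lemma smooth_on_slice_point: "open S \<Longrightarrow> smooth_on S (\<lambda>y. slice_point c y $ i)"
  using exhaust_5[of i] by (auto simp: slice_point_nth intro!: smooth_on_intros smooth_on_nth)

lemma smooth_on_F_args: "open S \<Longrightarrow> smooth_on S (\<lambda>z. F_args (fst z) (snd z) $ i)"
proof -
  assume S: "open S"
  have "smooth_on S (\<lambda>z. fst z $ j)" for j :: 5
    by (intro smooth_on_linear S bounded_linear_compose[OF bounded_linear_vec_nth bounded_linear_fst])
  moreover have "smooth_on S (snd :: (real ^ 5) \<times> real \<Rightarrow> real)"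
    by (intro smooth_on_linear S bounded_linear_snd)
  ultimately show ?thesis
    using exhaust_5[of i] by (auto simp: F_args_nth intro!: smooth_on_intros S)
qed

lemma continuous_on_vec_componentwise:
  assumes "\<And>i. continuous_on S (\<lambda>x. g x $ i)" shows "continuous_on S g"
  using continuous_on_vec_lambda[of S "\<lambda>i x. g x $ i"] assms by simp

text \<open>A short curve segment joins \<open>x\<close> to the slice through \<open>p\<close>. By
  \<open>solution_constant_along_flow\<close>, \<open>t\<close> equals \<open>s\<close> at one end
  exactly when it does at the other, so comparing on the slice detects
  \<open>s = t x\<close>.\<close>

lemma obtained_by_solving_if_solves_pde:
  assumes "open U" "smooth_on U t" "solves_pde_on U t" "p \<in> U"
  shows "\<exists>W F. open W \<and> smooth_on W F \<and> solvable_at W F p (t p) \<and> obtained_by_solving_near W F U t p"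
proof -
  define c where "c = p $ 4"
  define W where "W = slice_point c -` U"
  \<comment> \<open>For \<open>y = F_args x s\<close> the entry \<open>y $ 4\<close> is
    \<open>s\<close>.\<close>
  define F where "F y = t (slice_point c y) - y $ 4" for y
  have F: "F (F_args x s) = t (flow s x (c - x $ 4)) - s" for x s
    by (simp add: F_def slice_point_F_args F_args_nth)
  have W: "F_args x s \<in> W \<longleftrightarrow> flow s x (c - x $ 4) \<in> U" for x s
    by (simp add: W_def slice_point_F_args)
  have "continuous_on UNIV (slice_point c)"
    by (intro continuous_on_vec_componentwise smooth_on_imp_continuous_on smooth_on_slice_point open_UNIV)
  then have "open W" unfolding W_def using assms(1) by (simp add: open_vimage)
  moreover have "smooth_on W F"
    unfolding F_def using \<open>open W\<close> assms
    by (intro smooth_on_diff smooth_on_nth smooth_on_compose_vec[of W U t] smooth_on_slice_point)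
      (auto simp: W_def)
  moreover have "solvable_at W F p (t p)"
  proof -
    \<comment> \<open>Since \<open>p\<close> lies on the slice, its flow time is 0 and
      \<open>F (F_args p r)\<close> reduces to \<open>t p - r\<close>.\<close>
    have "deriv (\<lambda>r. t p - r) (t p) = - 1"
      by (rule DERIV_imp_deriv) (auto intro!: derivative_eq_intros)
    then show ?thesis using assms(4) by (simp add: solvable_at_def F W c_def)
  qed
  moreover have "obtained_by_solving_near W F U t p"
  proof -
    \<comment> \<open>Joint continuity in point, parameter and time gives one bound \<open>e\<close>
      on the times for which all nearby curves stay in \<open>U\<close>.\<close>
    define \<Phi> where "\<Phi> = (\<lambda>z. flow (fst (snd z)) (fst z) (snd (snd z)))"
    have "continuous_on UNIV \<Phi>"
      unfolding \<Phi>_def flow_def char_dir_def by (intro continuous_intros)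
    then have "open (\<Phi> -` U)" using assms(1) by (simp add: open_vimage)
    moreover have "(p, t p, 0) \<in> \<Phi> -` U" using assms(4) by (simp add: \<Phi>_def)
    ultimately obtain A Z where AZ: "open A" "open Z" "p \<in> A" "(t p, 0) \<in> Z" "A \<times> Z \<subseteq> \<Phi> -` U"
      by (metis open_prod_elim mem_Sigma_iff)
    obtain B C where BC: "open B" "open C" "t p \<in> B" "0 \<in> C" "B \<times> C \<subseteq> Z"
      using open_prod_elim[OF AZ(2,4)] by (metis mem_Sigma_iff)
    obtain e where e: "e > 0" "ball 0 e \<subseteq> C" using BC(2,4) open_contains_ball by blast
    have inU: "flow s x \<tau> \<in> U" if "x \<in> A" "s \<in> B" "\<bar>\<tau>\<bar> < e" for x s \<tau>
    proof -
      have "(x, s, \<tau>) \<in> A \<times> Z" using that e BC(5) by (auto simp: dist_real_def)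
      then show ?thesis using AZ(5) by (auto simp: \<Phi>_def)
    qed
    define N where "N = (A \<inter> {x. \<bar>c - x $ 4\<bar> < e}) \<times> B"
    have "open {x::real^5. \<bar>c - x $ 4\<bar> < e}"
      by (intro open_Collect_less continuous_intros)
    then have "open N" unfolding N_def using AZ BC by (intro open_Times open_Int)
    moreover have "(p, t p) \<in> N" unfolding N_def using AZ BC e by (simp add: c_def)
    moreover have "x \<in> U \<and> F_args x s \<in> W \<and> (F (F_args x s) = 0 \<longleftrightarrow> s = t x)" if "(x, s) \<in> N" for x s
    proof -
      define d where "d = c - x $ 4"
      have x: "x \<in> A" "s \<in> B" "\<bar>d\<bar> < e" using that by (auto simp: N_def d_def)
      \<comment> \<open>The symmetric interval contains both 0 and \<open>d\<close> whatever the
        sign of \<open>d\<close>.\<close>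
      have U: "flow s x \<tau> \<in> U" if "\<tau> \<in> {-\<bar>d\<bar>..\<bar>d\<bar>}" for \<tau>
        using inU[OF x(1,2)] that x(3) by auto
      have const: "t (flow s x b) = s" if "a \<in> {-\<bar>d\<bar>..\<bar>d\<bar>}" "t (flow s x a) = s" "b \<in> {-\<bar>d\<bar>..\<bar>d\<bar>}" for a b
        using solution_constant_along_flow[OF assms(2,3) U that] .
      have mem: "0 \<in> {-\<bar>d\<bar>..\<bar>d\<bar>}" "d \<in> {-\<bar>d\<bar>..\<bar>d\<bar>}"
        unfolding atLeastAtMost_iff by linarith+
      have "t (flow s x d) = s \<longleftrightarrow> t x = s"
        using const[OF mem(1) _ mem(2)] const[OF mem(2) _ mem(1)] unfolding flow_0 by blast
      then show ?thesis
        using U[OF mem(1)] U[OF mem(2)] unfolding W F flow_0 d_def[symmetric] by auto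
    qed
    ultimately show ?thesis unfolding obtained_by_solving_near_def by blast
  qed
  ultimately show ?thesis by blast
qed

text \<open>The implicit function theorem is applied to \<open>H (x, r) = F (F_args x r)\<close>;
  the one-variable derivative in \<open>solvable_at\<close> has to be recognised as the derivative
  of \<open>H\<close> in direction \<open>(0, 1)\<close>.\<close>

lemma solution_exists_if_solvable_at:
  assumes "open W" "smooth_on W F" "solvable_at W F p s"
  shows "\<exists>U t. open U \<and> p \<in> U \<and> smooth_on U t \<and> t p = s \<and> (\<forall>q\<in>U. obtained_by_solving_near W F U t q)"
proof -
  define G where "G = (\<lambda>z. F_args (fst z) (snd z))"
  define H where "H z = F (G z)" for z
  define S where "S = G -` W"
  have "continuous_on UNIV G"
    unfolding G_def
    by (intro continuous_on_vec_componentwise smooth_on_imp_continuous_on smooth_on_F_args open_UNIV)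
  then have "open S" unfolding S_def using assms(1) by (simp add: open_vimage)
  have "smooth_on S H"
    unfolding H_def using \<open>open S\<close> assms
    by (intro smooth_on_compose_vec[of S W F]) (auto simp: G_def S_def intro: smooth_on_F_args)
  have pS: "(p, s) \<in> S" and H0: "H (p, s) = 0" and nz: "deriv (\<lambda>r. H (p, r)) s \<noteq> 0"
    using assms(3) by (auto simp: solvable_at_def S_def G_def H_def)
  have "((\<lambda>r. (p, r)) has_derivative (\<lambda>h. (0, h))) (at s)"
    by (intro has_derivative_Pair has_derivative_const has_derivative_ident)
  from has_derivative_compose[OF this smooth_on_has_derivative[OF \<open>smooth_on S H\<close> pS]]
  have d: "((\<lambda>r. H (p, r)) has_derivative (\<lambda>h. frechet_derivative H (at (p, s)) (0, h))) (at s)" .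
  have "linear (\<lambda>h. frechet_derivative H (at (p, s)) (0, h))"
    using d has_derivative_linear by blast
  have "frechet_derivative H (at (p, s)) (0, h) = frechet_derivative H (at (p, s)) (0, 1) * h" for h
    using linear_cmul[OF \<open>linear _\<close>, of h 1] by (simp add: mult.commute)
  then have "(\<lambda>h. frechet_derivative H (at (p, s)) (0, h)) = (*) (frechet_derivative H (at (p, s)) (0, 1))"
    by blast
  then have "deriv (\<lambda>r. H (p, r)) s = frechet_derivative H (at (p, s)) (0, 1)"
    using d by (intro DERIV_imp_deriv) (simp add: has_field_derivative_def)
  then have "frechet_derivative H (at (p, s)) (0, 1) \<noteq> 0" using nz by simp
  then obtain U V t where UV: "open U" "p \<in> U" "open V" "s \<in> V" "U \<times> V \<subseteq> S" "smooth_on U t" "t p = s"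
    and V: "\<And>x. x \<in> U \<Longrightarrow> t x \<in> V" and iff: "\<And>x r. x \<in> U \<Longrightarrow> r \<in> V \<Longrightarrow> H (x, r) = 0 \<longleftrightarrow> r = t x"
    by (rule smooth_implicit_function[OF \<open>open S\<close> \<open>smooth_on S H\<close> pS H0]) (rule that)
  have "obtained_by_solving_near W F U t q" if "q \<in> U" for q
    unfolding obtained_by_solving_near_def
  \<comment> \<open>The same box serves as neighbourhood for every \<open>q\<close> in
    \<open>U\<close>.\<close>
  proof (intro exI[of _ "U \<times> V"] conjI ballI)
    show "open (U \<times> V)" "(q, t q) \<in> U \<times> V" using UV V that by (auto intro: open_Times)
    fix z assume "z \<in> U \<times> V"
    then show "case z of (x, r) \<Rightarrow> x \<in> U \<and> F_args x r \<in> W \<and> (F (F_args x r) = 0 \<longleftrightarrow> r = t x)"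
      using UV(5) iff by (auto simp: S_def G_def H_def)
  qed
  then show ?thesis using UV by blast
qed

text \<open>Being the general solution is split into soundness, local completeness, and existence of
  a solution for each \<open>F\<close> meeting the implicit function condition.\<close>

theorem theorem3:
  shows
    "(\<forall>W F U t. open W \<and> smooth_on W F \<and> open U \<and> smooth_on U t \<and>
        (\<forall>p\<in>U. obtained_by_solving_near W F U t p) \<longrightarrow> solves_pde_on U t)
     \<and>
     (\<forall>U t p. open U \<and> smooth_on U t \<and> solves_pde_on U t \<and> p \<in> U \<longrightarrow>
        (\<exists>W F. open W \<and> smooth_on W F \<and> solvable_at W F p (t p) \<and>
           obtained_by_solving_near W F U t p))
     \<and>
     (\<forall>W F p s. open W \<and> smooth_on W F \<and> solvable_at W F p s \<longrightarrow>
        (\<exists>U t. open U \<and> p \<in> U \<and> smooth_on U t \<and> t p = s \<and>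
           (\<forall>q\<in>U. obtained_by_solving_near W F U t q)))"
proof (intro conjI allI impI; elim conjE)
  show "solves_pde_on U t" if "smooth_on U t" "\<forall>p\<in>U. obtained_by_solving_near W F U t p" for W F U t
    using that solves_pde_if_obtained_by_solving by blast
qed (fact obtained_by_solving_if_solves_pde, fact solution_exists_if_solvable_at)

end
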